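(* Let $x=(x_k)_{k\ge 1}$ be a bounded sequence of complex numbers with $x_1=1$ that is totally multiplicative, i.e. $x_{nk}=x_nx_k$ for all integers $n,k\ge 1$. Let $(a_k)_{k\ge1}$ be a sequence of complex numbers with $\sum_{k\ge 1}|a_k|<\infty$. If $$\sum_{k\ge 1}x_k a_{nk}=0\qquad\text{for all } n\ge 1,$$ then $a_j=0$ for all $j\ge 1$. *)

theory Defs
  imports "HOL-Analysis.Analysis"
begin

end

theory Submission
  imports Defs "HOL-Computational_Algebra.Primes"
begin

text \<open>
  A bounded totally multiplicative sequence satisfies \<open>norm (x k) \<le> 1\<close>, so all sums below converge
  absolutely. Sieving by the primes one at a time, the terms divisible by \<open>p\<close> in the sum for \<open>n\<close>
  form \<open>x p\<close> times the sum for \<open>n * p\<close>, hence the relation persists when \<open>k\<close> is restricted to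
  integers without prime factors \<open>\<le> N\<close>. What remains is \<open>a n\<close> plus a tail over \<open>k > N\<close>.
\<close>

definition rough :: "nat \<Rightarrow> nat set" where
  "rough N = {k. 1 \<le> k \<and> (\<forall>p\<le>N. prime p \<longrightarrow> \<not> p dvd k)}"

lemma rough_0: "rough 0 = {1..}"
  by (auto simp: rough_def)

lemma rough_subset: "rough N \<subseteq> {1..}"
  by (auto simp: rough_def)

lemma one_in_rough: "1 \<in> rough N"
  by (auto simp: rough_def)

text \<open>A prime factor of \<open>k\<close> exceeds \<open>N\<close> and is at most
  \<open>k\<close>. This turns what survives the sieve, apart from \<open>k = 1\<close>, into a
  tail.\<close>

lemma rough_gt:
  assumes "k \<in> rough N" "k \<noteq> 1"
  shows "k > N"
proof -
  obtain p where p: "prime p" "p dvd k"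
    using prime_factor_nat[OF assms(2)] by blast
  then have "p > N"
    using assms(1) unfolding rough_def by (metis (mono_tags, lifting) mem_Collect_eq not_le)
  moreover have "p \<le> k"
    using p assms(1) by (intro dvd_imp_le) (auto simp: rough_def)
  ultimately show ?thesis by simp
qed

lemma rough_Suc_not_prime:
  assumes "\<not> prime (Suc N)"
  shows "rough (Suc N) = rough N"
  using assms by (auto simp: rough_def le_Suc_eq)

text \<open>The cofactor \<open>m\<close> of a multiple \<open>Suc N * m\<close> in
  \<open>rough N\<close> divides it, so it has no new prime factors and is again in
  \<open>rough N\<close>. Writing the sieved-out part as an image allows reindexing its sum by
  \<open>m\<close>.\<close>

lemma rough_Suc_prime:
  assumes "prime (Suc N)"
  shows "rough (Suc N) = rough N - (*) (Suc N) ` rough N"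
proof (rule set_eqI)
  fix k
  have "m \<in> rough N" if "k = Suc N * m" "k \<in> rough N" for m
  proof -
    have "m \<noteq> 0" using that by (intro notI) (simp add: rough_def)
    moreover have "\<not> p dvd m" if "p \<le> N" "prime p" for p
      using that \<open>k = Suc N * m\<close> \<open>k \<in> rough N\<close> by (auto simp: rough_def)
    ultimately show ?thesis by (auto simp: rough_def)
  qed
  then have "k \<in> (*) (Suc N) ` rough N \<longleftrightarrow> Suc N dvd k" if "k \<in> rough N"
    using that by (auto simp del: mult_Suc)
  moreover have "k \<in> rough (Suc N) \<longleftrightarrow> k \<in> rough N \<and> \<not> Suc N dvd k"
    using assms by (auto simp: rough_def le_Suc_eq)
  ultimately show "k \<in> rough (Suc N) \<longleftrightarrow> k \<in> rough N - (*) (Suc N) ` rough N"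
    by blast
qed

text \<open>The only prime factor of the prime \<open>Suc N\<close> is itself, so no prime up to
  \<open>N\<close> enters the product. The inclusion is what subtracting the two sums
  requires.\<close>

lemma mult_image_rough_subset:
  assumes "prime (Suc N)"
  shows "(*) (Suc N) ` rough N \<subseteq> rough N"
proof -
  have "\<not> p dvd Suc N" if "prime p" "p \<le> N" for p
    using that assms primes_dvd_imp_eq[of p "Suc N"] by auto
  then show ?thesis
    by (auto simp: rough_def prime_dvd_mult_iff simp del: mult_Suc)
qed

text \<open>Each power of \<open>x k\<close> is again a value of \<open>x\<close>, at
  \<open>k ^ m\<close>; a norm above 1 would make these powers unbounded.\<close>

lemma norm_le_1_if_bounded_multiplicative:
  fixes x :: "nat \<Rightarrow> 'a::real_normed_field"
  assumes "bounded (x ` {1..})" "x 1 = 1"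
    and mult: "\<And>n k. n \<ge> 1 \<Longrightarrow> k \<ge> 1 \<Longrightarrow> x (n * k) = x n * x k"
    and "k \<ge> 1"
  shows "norm (x k) \<le> 1"
proof (rule ccontr)
  assume "\<not> norm (x k) \<le> 1"
  obtain B where B: "norm (x n) \<le> B" if "n \<ge> 1" for n
    using assms(1) unfolding bounded_iff by auto
  have "x (k ^ m) = x k ^ m" for m
    using \<open>k \<ge> 1\<close> \<open>x 1 = 1\<close> by (induction m) (auto simp: mult)
  then have "norm (x k) ^ m \<le> B" for m
    using B[of "k ^ m"] \<open>k \<ge> 1\<close> by (simp add: norm_power)
  moreover obtain m where "B < norm (x k) ^ m"
    using real_arch_pow \<open>\<not> norm (x k) \<le> 1\<close> by (metis not_le)
  ultimately show False
    by (metis not_le)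
qed

lemma summable_on_dilation:
  fixes x a :: "nat \<Rightarrow> 'a::{real_normed_field,banach}"
  assumes "summable (\<lambda>k. norm (a (Suc k)))"
    and x: "\<And>k. k \<ge> 1 \<Longrightarrow> norm (x k) \<le> 1"
    and "n \<ge> 1"
  shows "(\<lambda>k. norm (x k * a (n * k))) summable_on {1..}"
proof -
  have "(\<lambda>k. norm (a (Suc k))) summable_on UNIV"
    using assms(1) by (intro summable_nonneg_imp_summable_on) auto
  then have "(\<lambda>k. norm (a k)) summable_on range Suc"
    by (subst summable_on_reindex) (auto simp: o_def)
  \<comment> \<open>Since \<open>n \<ge> 1\<close>, dilation by \<open>n\<close> is injective, so
    the dilated family is a subfamily of an absolutely summable one.\<close>
  then have "(\<lambda>k. norm (a k)) summable_on (*) n ` {1..}"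
    by (rule summable_on_subset_banach) (use \<open>n \<ge> 1\<close> in \<open>auto simp: greaterThan_0[symmetric]\<close>)
  then have *: "(\<lambda>k. norm (a (n * k))) summable_on {1..}"
    using \<open>n \<ge> 1\<close> by (subst (asm) summable_on_reindex) (auto simp: o_def inj_on_def)
  have "norm (x k * a (n * k)) \<le> norm (a (n * k))" if "k \<in> {1..}" for k
    using x[of k] that by (simp add: norm_mult mult_left_le_one_le)
  then show ?thesis
    by (intro summable_on_comparison_test[OF *]) auto
qed

lemma has_sum_rough:
  fixes x a :: "nat \<Rightarrow> 'a::real_normed_field"
  assumes mult: "\<And>n k. n \<ge> 1 \<Longrightarrow> k \<ge> 1 \<Longrightarrow> x (n * k) = x n * x k"
    and sum0: "\<And>n. n \<ge> 1 \<Longrightarrow> ((\<lambda>k. x k * a (n * k)) has_sum 0) {1..}"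
    and "n \<ge> 1"
  shows "((\<lambda>k. x k * a (n * k)) has_sum 0) (rough N)"
  using \<open>n \<ge> 1\<close>
\<comment> \<open>\<open>n\<close> must vary, since sieving by the prime \<open>Suc N\<close> uses
  the induction hypothesis both at \<open>n\<close> and at \<open>n * Suc N\<close>.\<close>
proof (induction N arbitrary: n)
  case 0
  then show ?case unfolding rough_0 by (rule sum0)
next
  case (Suc N)
  show ?case
  proof (cases "prime (Suc N)")
    case False
    then show ?thesis using Suc by (simp add: rough_Suc_not_prime)
  next
    case True
    have "((\<lambda>m. x (Suc N) * (x m * a (n * Suc N * m))) has_sum x (Suc N) * 0) (rough N)"
      using Suc.IH[of "n * Suc N"] Suc.prems by (intro has_sum_cmult_right) auto
    then have "((\<lambda>m. x (Suc N * m) * a (n * (Suc N * m))) has_sum 0) (rough N)"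
      by (subst (asm) has_sum_cong[where g = "\<lambda>m. x (Suc N * m) * a (n * (Suc N * m))"])
         (auto simp: rough_def mult mult.assoc simp del: mult_Suc mult_Suc_right)
    then have "((\<lambda>k. x k * a (n * k)) has_sum 0) ((*) (Suc N) ` rough N)"
      by (subst has_sum_reindex) (auto simp: o_def inj_on_def simp del: mult_Suc)
    from has_sum_Diff[OF Suc.IH[OF Suc.prems] this mult_image_rough_subset[OF True]]
    show ?thesis by (simp add: rough_Suc_prime[OF True])
  qed
qed

theorem lemma1p2:
  fixes x a :: "nat \<Rightarrow> complex"
  assumes "bounded (x ` {1..})"
    and "x 1 = 1"
    and "\<And>n k. n \<ge> 1 \<Longrightarrow> k \<ge> 1 \<Longrightarrow> x (n * k) = x n * x k"
    and "summable (\<lambda>k. norm (a (Suc k)))"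
    and "\<And>n. n \<ge> 1 \<Longrightarrow> (\<Sum>k. x (Suc k) * a (n * Suc k)) = 0"
  shows "\<forall>j\<ge>1. a j = 0"
proof (intro allI impI)
  fix j :: nat
  assume "j \<ge> 1"
  define g where "g n k = x k * a (n * k)" for n k
  have norm_x: "norm (x k) \<le> 1" if "k \<ge> 1" for k
    using norm_le_1_if_bounded_multiplicative[of x k] assms(1-3) that by blast
  have abs: "(\<lambda>k. norm (g n k)) summable_on {1..}" if "n \<ge> 1" for n
    using summable_on_dilation[of a x n] assms(4) norm_x that unfolding g_def by blast
  have range_Suc: "range Suc = {1..}"
    by (simp add: greaterThan_0[symmetric] atLeast_Suc_greaterThan)
  \<comment> \<open>An equation for \<open>suminf\<close> does not by itself assert convergence.
    Absolute summability supplies it and identifies the ordered series with the unordered sum, which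
    can be split over subsets.\<close>
  have "(g n has_sum 0) {1..}" if "n \<ge> 1" for n
  proof -
    have "g n summable_on {1..}"
      using abs[OF that] by (rule abs_summable_summable)
    then have "(g n has_sum infsum (g n) {1..}) (range Suc)"
      by (simp add: range_Suc)
    then have "((\<lambda>k. g n (Suc k)) has_sum infsum (g n) {1..}) UNIV"
      by (subst (asm) has_sum_reindex) (auto simp: o_def)
    then have "infsum (g n) {1..} = (\<Sum>k. g n (Suc k))"
      by (metis has_sum_imp_sums sums_unique)
    also have "\<dots> = 0"
      using assms(5)[OF that] by (simp only: g_def)
    finally show ?thesis
      using has_sum_infsum[OF \<open>g n summable_on {1..}\<close>] by simp
  qed
  then have rough0: "(g j has_sum 0) (rough N)" for N
    using has_sum_rough[of x a j N] assms(3) \<open>j \<ge> 1\<close> unfolding g_def by blast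
  have "norm (a j) \<le> e" if "e > 0" for e :: real
  proof -
    let ?s = "\<lambda>A. infsum (\<lambda>k. norm (g j k)) A"
    \<comment> \<open>\<open>F\<close> carries all but at most \<open>e\<close> of the absolute sum.
      Sieving up to a bound \<open>N\<close> of \<open>F\<close> then leaves only 1 and indices
      outside \<open>F\<close>.\<close>
    obtain F where F: "finite F" "F \<subseteq> {1..}" "dist (\<Sum>k\<in>F. norm (g j k)) (?s {1..}) \<le> e"
      using infsum_finite_approximation[OF abs[OF \<open>j \<ge> 1\<close>] \<open>e > 0\<close>] by blast
    obtain N where N: "k \<le> N" if "k \<in> F" for k
      using F(1) finite_nat_set_iff_bounded_le by auto
    \<comment> \<open>The term at 1 is \<open>a j\<close>, because \<open>x 1 = 1\<close>; the
      remaining terms must cancel it, so their absolute sum bounds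
      \<open>norm (a j)\<close>.\<close>
    have "(g j has_sum 0 - g j 1) (rough N - {1})"
      using rough0 one_in_rough by (intro has_sum_Diff) (auto simp: has_sum_finite_iff)
    moreover have sub: "rough N - {1} \<subseteq> {1..}"
      using rough_subset by blast
    ultimately have "norm (0 - g j 1) \<le> ?s (rough N - {1})"
      using norm_infsum_le[OF _ has_sum_infsum[OF summable_on_subset_banach[OF abs[OF \<open>j \<ge> 1\<close>]]]]
      by blast
    also have "\<dots> \<le> ?s ({1..} - F)"
    proof (rule infsum_mono2)
      show "rough N - {1} \<subseteq> {1..} - F"
        using sub rough_gt[of _ N] N by fastforce
      show "(\<lambda>k. norm (g j k)) summable_on rough N - {1}"
        by (rule summable_on_subset_banach[OF abs[OF \<open>j \<ge> 1\<close>] sub])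
      show "(\<lambda>k. norm (g j k)) summable_on {1..} - F"
        by (rule summable_on_subset_banach[OF abs[OF \<open>j \<ge> 1\<close>]]) auto
    qed simp
    also have "\<dots> = ?s {1..} - (\<Sum>k\<in>F. norm (g j k))"
      using abs[OF \<open>j \<ge> 1\<close>] F by (subst infsum_Diff) auto
    also have "\<dots> \<le> e"
      using F(3) by (simp add: dist_real_def)
    finally show ?thesis
      using assms(2) by (simp add: g_def)
  qed
  then have "norm (a j) \<le> 0"
    by (rule dense_ge)
  then show "a j = 0" by simp
qed

end
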